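(* Let $\mathfrak{A}$ be a residuated lattice. The following assertions are equivalent: (1) $\mathfrak{A}$ is quasicomplemented; (2) any prime $\alpha$-filter of $\mathfrak{A}$ is a minimal prime filter; (3) any proper $\alpha$-filter of $\mathfrak{A}$ is the intersection of minimal prime filters; (4) any proper $\alpha$-filter of $\mathfrak{A}$ is contained in a minimal prime filter.
   Context: A residuated lattice $\mathfrak{A}=(A;\vee,\wedge,\odot,\rightarrow,0,1)$ is an algebra such that $(A;\vee,\wedge,0,1)$ is a bounded lattice, $(A;\odot,1)$ is a commutative monoid, and $x\odot y\leq z$ iff $x\leq y\rightarrow z$. A filter is a non-empty $F\subseteq A$ closed under $\odot$ and such that $x\in F$, $y\in A$ imply $x\vee y\in F$; it is proper if $F\neq A$. A prime filter is a proper filter $P$ such that $x\vee y\in P$ implies $x\in P$ or $y\in P$; a minimal prime filter is a prime filter minimal under inclusion among all prime filters. For $X\subseteq A$, $X^{\perp}=\{a\in A\mid a\vee x=1\ \forall x\in X\}$; $x^{\perp}:=\{x\}^{\perp}$ and $x^{\perp\perp}:=(x^{\perp})^{\perp}$. $\mathfrak{A}$ is quasicomplemented if for every $x\in A$ there is $y\in A$ with $x^{\perp\perp}=y^{\perp}$. A filter $F$ is an $\alpha$-filter if $x^{\perp\perp}\subseteq F$ for every $x\in F$; a prime $\alpha$-filter is a prime filter that is an $\alpha$-filter. *)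

theory Defs
  imports Main
begin

text \<open>The universe of the algebra is the whole type; the lattice order and the constants
  \<open>0\<close> and \<open>1\<close> are \<open>\<le>\<close>, \<open>bot\<close> and \<open>top\<close> of the bounded lattice. The case \<open>bot = top\<close> is allowed.\<close>

class residuated_lattice = bounded_lattice +
  fixes rmult :: "'a \<Rightarrow> 'a \<Rightarrow> 'a"  (infixl "\<odot>" 70)
    and rimp :: "'a \<Rightarrow> 'a \<Rightarrow> 'a"  (infixr "\<rightarrow>" 60)
  assumes rmult_assoc: "(x \<odot> y) \<odot> z = x \<odot> (y \<odot> z)"
    and rmult_commute: "x \<odot> y = y \<odot> x"
    and rmult_top: "x \<odot> top = x"
    and residuation: "x \<odot> y \<le> z \<longleftrightarrow> x \<le> y \<rightarrow> z"

definition rl_filter :: "'a::residuated_lattice set \<Rightarrow> bool" where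
  "rl_filter F \<longleftrightarrow>
     F \<noteq> {} \<and> (\<forall>x\<in>F. \<forall>y\<in>F. x \<odot> y \<in> F) \<and> (\<forall>x\<in>F. \<forall>y. sup x y \<in> F)"

definition proper_filter :: "'a::residuated_lattice set \<Rightarrow> bool" where
  "proper_filter F \<longleftrightarrow> rl_filter F \<and> F \<noteq> UNIV"

definition prime_filter :: "'a::residuated_lattice set \<Rightarrow> bool" where
  "prime_filter P \<longleftrightarrow> proper_filter P \<and> (\<forall>x y. sup x y \<in> P \<longrightarrow> x \<in> P \<or> y \<in> P)"

definition minimal_prime_filter :: "'a::residuated_lattice set \<Rightarrow> bool" where
  "minimal_prime_filter P \<longleftrightarrow> prime_filter P \<and> (\<forall>Q. prime_filter Q \<and> Q \<subseteq> P \<longrightarrow> Q = P)"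

definition perp :: "'a::residuated_lattice set \<Rightarrow> 'a set" where
  "perp X = {a. \<forall>x\<in>X. sup a x = top}"

definition quasicomplemented :: "'a::residuated_lattice itself \<Rightarrow> bool" where
  "quasicomplemented _ \<longleftrightarrow> (\<forall>x::'a. \<exists>y::'a. perp (perp {x}) = perp {y})"

definition alpha_filter :: "'a::residuated_lattice set \<Rightarrow> bool" where
  "alpha_filter F \<longleftrightarrow> rl_filter F \<and> (\<forall>x\<in>F. perp (perp {x}) \<subseteq> F)"

end

theory Submission
  imports Defs
begin

text \<open>For an \<open>\<alpha>\<close>-filter \<open>P\<close> and any \<open>b\<close>, the set \<open>{z. sup z b \<in> P}\<close> is an \<open>\<alpha>\<close>-filter containing
  \<open>P\<close>. This makes an \<open>\<alpha>\<close>-filter that is maximal among those missing a join-closed set \<open>T\<close> prime,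
  without computing generated filters. Taking \<open>T\<close> a singleton shows that a proper \<open>\<alpha>\<close>-filter is an
  intersection of prime \<open>\<alpha>\<close>-filters; extending the \<open>\<alpha>\<close>-filter \<open>{top}\<close> yields that a minimal prime
  \<open>M\<close> containing \<open>x\<close> cannot contain \<open>perp {x}\<close>. Hence the \<open>\<alpha>\<close>-filter generated by \<open>x\<close> and
  \<open>perp {x}\<close> lies in no minimal prime. If it is therefore improper, some \<open>y \<in> perp {x}\<close> satisfies
  \<open>perp {x} \<inter> perp {y} = {top}\<close>, and such a \<open>y\<close> is a quasicomplement of \<open>x\<close>.\<close>

section \<open>Residuated arithmetic and filters\<close>

lemma rmult_mono:
  fixes a b c d :: "'a::residuated_lattice"
  assumes "a \<le> b" "c \<le> d"
  shows "a \<odot> c \<le> b \<odot> d"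
proof -
  \<comment> \<open>The unit of the adjunction between \<open>\<odot>\<close> and
    \<open>\<rightarrow>\<close>; monotonicity follows by transitivity.\<close>
  have "b \<le> c \<rightarrow> (b \<odot> c)" by (simp flip: residuation)
  then have 1: "a \<odot> c \<le> b \<odot> c" using assms(1) order_trans by (auto simp: residuation)
  have "d \<le> b \<rightarrow> (d \<odot> b)" by (simp flip: residuation)
  then have "c \<odot> b \<le> d \<odot> b" using assms(2) order_trans by (auto simp: residuation)
  with 1 show ?thesis using order_trans by (metis rmult_commute)
qed

lemma rmult_le1: "x \<odot> y \<le> (x::'a::residuated_lattice)"
  using rmult_mono[of x x y top] by (simp add: rmult_top)

lemma rmult_le2: "x \<odot> y \<le> (y::'a::residuated_lattice)"
  using rmult_le1[of y x] by (simp add: rmult_commute)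

text \<open>Multiplication by \<open>x\<close> has a right adjoint and therefore preserves
  joins.\<close>

lemma rmult_sup_distrib:
  fixes x y z :: "'a::residuated_lattice"
  shows "x \<odot> sup y z = sup (x \<odot> y) (x \<odot> z)"
proof (rule order.antisym)
  have "y \<le> x \<rightarrow> sup (x \<odot> y) (x \<odot> z)" "z \<le> x \<rightarrow> sup (x \<odot> y) (x \<odot> z)"
    by (simp_all add: rmult_commute[of _ x] flip: residuation)
  then have "sup y z \<odot> x \<le> sup (x \<odot> y) (x \<odot> z)" by (simp add: residuation)
  then show "x \<odot> sup y z \<le> sup (x \<odot> y) (x \<odot> z)" by (simp add: rmult_commute)
  show "sup (x \<odot> y) (x \<odot> z) \<le> x \<odot> sup y z" by (simp add: rmult_mono)
qed

text \<open>When the product is distributed over both joins, every term other than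
  \<open>x \<odot> y\<close> has a factor \<open>b\<close> and so lies below
  \<open>b\<close>.\<close>

lemma sup_rmult_le:
  fixes x y b :: "'a::residuated_lattice"
  shows "sup x b \<odot> sup y b \<le> sup (x \<odot> y) b"
proof -
  have "sup x b \<odot> y \<le> sup (x \<odot> y) b"
    using rmult_le1[of b y] by (simp add: rmult_commute[of _ y] rmult_sup_distrib le_supI2)
  then show ?thesis by (simp add: rmult_sup_distrib rmult_le2 le_supI2)
qed

lemma rl_filterI:
  assumes "F \<noteq> {}" "\<And>x y. x \<in> F \<Longrightarrow> y \<in> F \<Longrightarrow> x \<odot> y \<in> F" "\<And>x y. x \<in> F \<Longrightarrow> sup x y \<in> F"
  shows "rl_filter F"
  using assms by (simp add: rl_filter_def)

lemma rl_filter_upward: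
  assumes "rl_filter F" "x \<in> F" "x \<le> y"
  shows "y \<in> F"
  using assms by (metis rl_filter_def sup.absorb2)

lemma rl_filter_top: "rl_filter F \<Longrightarrow> top \<in> F"
  using rl_filter_upward top_greatest unfolding rl_filter_def by blast

lemma rl_filter_rmult: "rl_filter F \<Longrightarrow> x \<in> F \<Longrightarrow> y \<in> F \<Longrightarrow> x \<odot> y \<in> F"
  by (simp add: rl_filter_def)

text \<open>Closure under \<open>\<odot>\<close> comes from \<open>sup_rmult_le\<close>. The case
  \<open>P = {top}\<close> gives \<open>perp {b}\<close>.\<close>

lemma rl_filter_sup_vimage:
  assumes "rl_filter P"
  shows "rl_filter {z. sup z b \<in> P}"
proof -
  have "sup top b \<in> P" using rl_filter_top[OF assms] by simp
  moreover have "sup (x \<odot> y) b \<in> P" if "sup x b \<in> P" "sup y b \<in> P" for x y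
    using rl_filter_upward[OF assms rl_filter_rmult[OF assms that] sup_rmult_le] .
  moreover have "sup (sup x y) b \<in> P" if "sup x b \<in> P" for x y
    by (rule rl_filter_upward[OF assms that]) (simp add: le_supI1)
  ultimately show ?thesis unfolding rl_filter_def by blast
qed

section \<open>Annihilators\<close>

lemma perp_singleton: "perp {x} = {a. sup a x = top}"
  by (simp add: perp_def)

lemma rl_filter_singleton_top: "rl_filter {top :: 'a::residuated_lattice}"
  by (simp add: rl_filter_def rmult_top)

lemma rl_filter_perp: "rl_filter (perp X)"
proof -
  have "rl_filter (perp {x})" for x :: 'a
    using rl_filter_sup_vimage[OF rl_filter_singleton_top] by (simp add: perp_singleton)
  then have "rl_filter (\<Inter>x\<in>X. perp {x})"
    using rl_filter_top by (intro rl_filterI) (blast, simp_all add: rl_filter_def)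
  moreover have "perp X = (\<Inter>x\<in>X. perp {x})" by (auto simp: perp_def)
  ultimately show ?thesis by simp
qed

lemma perp_antimono: "X \<subseteq> Y \<Longrightarrow> perp Y \<subseteq> perp X"
  by (auto simp: perp_def)

lemma perp_extensive: "X \<subseteq> perp (perp X)"
  by (auto simp: perp_def sup.commute)

text \<open>One inclusion holds because the product lies below its factors. For the other,
  annihilation is symmetric, so \<open>x\<close> and \<open>y\<close> lie in the filter
  \<open>perp {a}\<close>, which is closed under products.\<close>

lemma perp_rmult: "perp {x \<odot> y} = perp {x} \<inter> perp {y}"
proof (intro set_eqI iffI)
  fix a assume "a \<in> perp {x \<odot> y}"
  then have "top \<le> sup a (x \<odot> y)" by (simp add: perp_singleton)
  moreover have "sup a (x \<odot> y) \<le> sup a x" "sup a (x \<odot> y) \<le> sup a y"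
    by (simp_all add: rmult_le1 rmult_le2 le_supI2)
  ultimately have "top \<le> sup a x" "top \<le> sup a y" using order_trans by blast+
  then show "a \<in> perp {x} \<inter> perp {y}" by (simp add: perp_singleton top_unique)
next
  fix a assume "a \<in> perp {x} \<inter> perp {y}"
  then have "x \<in> perp {a}" "y \<in> perp {a}" by (simp_all add: perp_singleton sup.commute)
  then have "x \<odot> y \<in> perp {a}" by (rule rl_filter_rmult[OF rl_filter_perp])
  then show "a \<in> perp {x \<odot> y}" by (simp add: perp_singleton sup.commute)
qed

lemma perp_inter_biperp: "perp X \<inter> perp (perp X) \<subseteq> {top}"
  by (auto simp: perp_def)

text \<open>\<open>perp\<close> forms a Galois connection with itself: the hypothesis amounts to
  \<open>perp Y \<subseteq> perp X\<close>, and one more \<open>perp\<close> reverses this.\<close>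

lemma biperp_mono: "X \<subseteq> perp (perp Y) \<Longrightarrow> perp (perp X) \<subseteq> perp (perp Y)"
  using perp_antimono perp_extensive by (metis order_trans)

section \<open>\<alpha>-filters and prime separation\<close>

lemma alpha_filter_sup_vimage:
  assumes "alpha_filter P"
  shows "alpha_filter {z. sup z b \<in> P}"
proof -
  have P: "rl_filter P" and "\<And>z. z \<in> P \<Longrightarrow> perp (perp {z}) \<subseteq> P"
    using assms by (auto simp: alpha_filter_def)
  \<comment> \<open>Joins with \<open>b\<close> can be shifted: \<open>c\<close> annihilates
    \<open>sup z b\<close> exactly when \<open>sup c b\<close> annihilates \<open>z\<close>, and
    then \<open>sup c b\<close> annihilates \<open>w\<close> as well.\<close>
  moreover have "sup w b \<in> perp (perp {sup z b})" if "w \<in> perp (perp {z})" for w z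
    unfolding perp_def[of "perp {sup z b}"]
  proof (intro CollectI ballI)
    fix c assume "c \<in> perp {sup z b}"
    then have "sup c b \<in> perp {z}" by (simp add: perp_singleton ac_simps)
    then have "sup w (sup c b) = top" using that by (simp add: perp_def)
    then show "sup (sup w b) c = top" by (simp add: ac_simps)
  qed
  ultimately show ?thesis using rl_filter_sup_vimage[OF P] unfolding alpha_filter_def by blast
qed

lemma alpha_filter_singleton_top: "alpha_filter {top :: 'a::residuated_lattice}"
  using perp_inter_biperp[of "{top :: 'a}"] rl_filter_singleton_top
  by (auto simp: alpha_filter_def perp_singleton)

lemma alpha_filter_Union_chain:
  assumes "C \<noteq> {}" "\<And>P. P \<in> C \<Longrightarrow> alpha_filter P" "\<And>P Q. P \<in> C \<Longrightarrow> Q \<in> C \<Longrightarrow> P \<subseteq> Q \<or> Q \<subseteq> P"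
  shows "alpha_filter (\<Union>C)"
proof -
  have filt: "rl_filter P" if "P \<in> C" for P using assms(2)[OF that] by (simp add: alpha_filter_def)
  have "x \<odot> y \<in> \<Union>C" if xy: "x \<in> \<Union>C" "y \<in> \<Union>C" for x y
  proof -
    obtain P where "P \<in> C" "x \<in> P" "y \<in> P"
      using xy assms(3) by blast
    then show ?thesis using rl_filter_rmult[OF filt] by blast
  qed
  moreover have "\<Union>C \<noteq> {}" using assms(1) rl_filter_top[OF filt] by blast
  moreover have "sup x y \<in> \<Union>C" if "x \<in> \<Union>C" for x y
    using that filt unfolding rl_filter_def by blast
  ultimately have "rl_filter (\<Union>C)" unfolding rl_filter_def by blast
  then show ?thesis using assms(2) unfolding alpha_filter_def by blast
qed

theorem prime_alpha_filter_separation: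
  assumes F: "alpha_filter F" and disj: "F \<inter> T = {}"
    and T: "T \<noteq> {}" "\<And>s t. s \<in> T \<Longrightarrow> t \<in> T \<Longrightarrow> sup s t \<in> T"
  obtains P where "prime_filter P" "alpha_filter P" "F \<subseteq> P" "P \<inter> T = {}"
proof -
  let ?A = "{P. alpha_filter P \<and> F \<subseteq> P \<and> P \<inter> T = {}}"
  have "\<Union>C \<in> ?A" if "C \<noteq> {}" "subset.chain ?A C" for C
    using that alpha_filter_Union_chain[of C] unfolding subset.chain_def by blast
  moreover have "?A \<noteq> {}" using F disj by blast
  ultimately have "\<exists>P\<in>?A. \<forall>Q\<in>?A. P \<subseteq> Q \<longrightarrow> Q = P" by (intro subset_Zorn_nonempty)
  then obtain P where P: "P \<in> ?A" and max: "\<And>Q. Q \<in> ?A \<Longrightarrow> P \<subseteq> Q \<Longrightarrow> Q = P"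
    by (rule bexE) blast
  then have filt: "rl_filter P" by (simp add: alpha_filter_def)
  \<comment> \<open>If the \<alpha>-filter \<open>{z. sup z b \<in> P}\<close> missed
    \<open>T\<close>, maximality would make it equal to \<open>P\<close>, although it contains
    \<open>a\<close>.\<close>
  have coset: "\<exists>t\<in>T. sup t b \<in> P" if "sup a b \<in> P" "a \<notin> P" for a b
  proof (rule ccontr)
    let ?J = "{z. sup z b \<in> P}"
    assume "\<not> ?thesis"
    moreover have "P \<subseteq> ?J" using filt by (auto simp: rl_filter_def)
    ultimately have "?J = P" using P alpha_filter_sup_vimage[of P b] by (intro max) auto
    then show False using that by blast
  qed
  have "a \<in> P \<or> b \<in> P" if ab: "sup a b \<in> P" for a b
  proof (rule ccontr)
    assume *: "\<not> ?thesis"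
    \<comment> \<open>Two exchanges: first \<open>a\<close> is replaced by \<open>t \<in> T\<close>,
      then \<open>b\<close> by \<open>s \<in> T\<close>, which leaves \<open>sup s t\<close> in both
      \<open>P\<close> and \<open>T\<close>.\<close>
    then obtain t where t: "t \<in> T" "sup t b \<in> P" using coset[OF ab] by blast
    then obtain s where "s \<in> T" "sup s t \<in> P" using coset[of b t] * by (auto simp: sup.commute)
    then show False using t T P by blast
  qed
  then have "prime_filter P" using P filt T(1) by (auto simp: prime_filter_def proper_filter_def)
  then show thesis using that P by blast
qed

section \<open>Minimal primes and quasicomplements\<close>

lemma minimal_prime_filterE:
  assumes M: "minimal_prime_filter M" and x: "x \<in> M"
  obtains y where "y \<in> perp {x}" "y \<notin> M"
proof (rule ccontr)
  assume "\<not> thesis"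
  then have sub: "perp {x} \<subseteq> M" using that by blast
  have prime: "prime_filter M" using M by (simp add: minimal_prime_filter_def)
  then have filt: "rl_filter M" and "M \<noteq> UNIV"
    by (auto simp: prime_filter_def proper_filter_def)
  then have bot: "bot \<notin> M" using rl_filter_upward bot_least by blast
  \<comment> \<open>This set misses \<open>top\<close>, since \<open>sup x u = top\<close> would put
    \<open>u\<close> in \<open>perp {x} \<subseteq> M\<close>, and it is join-closed because
    \<open>M\<close> is prime. A prime filter missing it lies in \<open>M\<close> but omits
    \<open>x = sup x bot\<close>, against minimality.\<close>
  let ?T = "(\<lambda>u. sup x u) ` (- M)"
  have "{top} \<inter> ?T = {}" using sub by (force simp: perp_singleton sup.commute)
  moreover have "?T \<noteq> {}" using bot by blast
  moreover have "sup s t \<in> ?T" if st: "s \<in> ?T" "t \<in> ?T" for s t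
  proof -
    obtain u v where uv: "u \<notin> M" "v \<notin> M" "s = sup x u" "t = sup x v" using st by auto
    then have "sup u v \<notin> M" using prime by (auto simp: prime_filter_def)
    moreover have "sup s t = sup x (sup u v)" using uv by (simp add: ac_simps)
    ultimately show ?thesis by blast
  qed
  ultimately obtain Q where Q: "prime_filter Q" "Q \<inter> ?T = {}"
    using prime_alpha_filter_separation[OF alpha_filter_singleton_top] by metis
  then have filtQ: "rl_filter Q" by (simp add: prime_filter_def proper_filter_def)
  have "Q \<subseteq> M"
  proof
    fix u assume "u \<in> Q"
    then have "sup x u \<in> Q" by (rule rl_filter_upward[OF filtQ]) simp
    then show "u \<in> M" using Q(2) by blast
  qed
  moreover have "x \<notin> Q"
  proof -
    have "sup x bot \<in> ?T" using bot by blast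
    then show ?thesis using Q(2) by auto
  qed
  ultimately show False using M Q x by (auto simp: minimal_prime_filter_def)
qed

text \<open>A quasicomplement \<open>y\<close> of \<open>x \<in> P\<close> lies outside
  \<open>P\<close>: otherwise \<open>P\<close> would contain the double annihilator of
  \<open>x \<odot> y\<close>, which is everything. As \<open>sup x y = top\<close> is in every prime
  \<open>Q \<subseteq> P\<close>, primeness forces \<open>x \<in> Q\<close>.\<close>

lemma quasicomplemented_minimal_prime:
  assumes qc: "quasicomplemented TYPE('a::residuated_lattice)"
    and P: "prime_filter (P :: 'a set)" "alpha_filter P"
  shows "minimal_prime_filter P"
proof -
  have filt: "rl_filter P" and ne: "P \<noteq> UNIV"
    using P by (auto simp: prime_filter_def proper_filter_def)
  have "P \<subseteq> Q" if Q: "prime_filter Q" "Q \<subseteq> P" for Q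
  proof
    fix x assume x: "x \<in> P"
    obtain y where y: "perp (perp {x}) = perp {y}"
      using qc by (auto simp: quasicomplemented_def)
    have "x \<in> perp {y}" using perp_extensive[of "{x}"] y by auto
    have "y \<notin> P"
    proof
      assume "y \<in> P"
      then have "perp (perp {x \<odot> y}) \<subseteq> P"
        using rl_filter_rmult[OF filt x] P(2) by (simp add: alpha_filter_def)
      moreover have "perp {x \<odot> y} \<subseteq> {top}"
        using perp_inter_biperp[of "{x}"] y by (simp add: perp_rmult)
      then have "perp (perp {x \<odot> y}) = UNIV" by (auto simp: perp_def)
      ultimately show False using ne by blast
    qed
    moreover have "sup x y \<in> Q"
      using \<open>x \<in> perp {y}\<close> Q(1) rl_filter_top[of Q]
      by (simp add: perp_singleton prime_filter_def proper_filter_def)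
    ultimately show "x \<in> Q" using Q by (auto simp: prime_filter_def)
  qed
  then show ?thesis using P(1) by (auto simp: minimal_prime_filter_def)
qed

text \<open>Each \<open>a \<notin> F\<close> is separated from \<open>F\<close> by taking
  \<open>T = {a}\<close>. For \<open>F = UNIV\<close> the family is empty and its intersection is
  again \<open>UNIV\<close>.\<close>

lemma alpha_filter_Inter_prime:
  assumes "alpha_filter F"
  shows "F = \<Inter>{P. prime_filter P \<and> alpha_filter P \<and> F \<subseteq> P}"
proof
  show "\<Inter>{P. prime_filter P \<and> alpha_filter P \<and> F \<subseteq> P} \<subseteq> F"
  proof (rule subsetI, rule ccontr)
    fix a assume a: "a \<in> \<Inter>{P. prime_filter P \<and> alpha_filter P \<and> F \<subseteq> P}" "a \<notin> F"
    obtain P where "prime_filter P" "alpha_filter P" "F \<subseteq> P" "P \<inter> {a} = {}"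
      using prime_alpha_filter_separation[OF assms, of "{a}"] a(2) by auto
    then show False using a(1) by auto
  qed
qed blast

text \<open>An explicit form of the \<alpha>-filter generated by \<open>x\<close> and
  \<open>perp {x}\<close>. The union is directed: the members for \<open>y\<close> and
  \<open>z\<close> both lie in the one for \<open>y \<odot> z\<close>.\<close>

lemma alpha_filter_Union_biperp:
  "alpha_filter (\<Union>y\<in>perp {x}. perp (perp {x \<odot> y}))" (is "alpha_filter ?F")
proof -
  have mono: "perp (perp {x \<odot> y}) \<subseteq> perp (perp {x \<odot> z})" if "z \<le> y" for y z
  proof (rule biperp_mono)
    have "x \<odot> z \<in> perp (perp {x \<odot> z})" using perp_extensive by blast
    then have "x \<odot> y \<in> perp (perp {x \<odot> z})"
      by (rule rl_filter_upward[OF rl_filter_perp]) (simp add: rmult_mono that)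
    then show "{x \<odot> y} \<subseteq> perp (perp {x \<odot> z})" by simp
  qed
  have mult: "a \<odot> b \<in> ?F" if ab: "a \<in> ?F" "b \<in> ?F" for a b
  proof -
    obtain y z where yz: "y \<in> perp {x}" "z \<in> perp {x}"
      "a \<in> perp (perp {x \<odot> y})" "b \<in> perp (perp {x \<odot> z})" using ab by blast
    have "a \<in> perp (perp {x \<odot> (y \<odot> z)})" using mono[OF rmult_le1] yz(3) by blast
    moreover have "b \<in> perp (perp {x \<odot> (y \<odot> z)})" using mono[OF rmult_le2] yz(4) by blast
    ultimately have "a \<odot> b \<in> perp (perp {x \<odot> (y \<odot> z)})"
      by (rule rl_filter_rmult[OF rl_filter_perp])
    moreover have "y \<odot> z \<in> perp {x}" using yz(1,2) by (rule rl_filter_rmult[OF rl_filter_perp])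
    ultimately show ?thesis by blast
  qed
  have "?F \<noteq> {}"
    using rl_filter_top[OF rl_filter_perp] by blast
  moreover note mult
  moreover have "sup a b \<in> ?F" if "a \<in> ?F" for a b
    using that rl_filter_upward[OF rl_filter_perp _ sup.cobounded1] by blast
  ultimately have "rl_filter ?F" by (rule rl_filterI)
  moreover have "perp (perp {a}) \<subseteq> ?F" if a: "a \<in> ?F" for a
  proof -
    obtain y where y: "y \<in> perp {x}" "a \<in> perp (perp {x \<odot> y})" using a by blast
    then have "perp (perp {a}) \<subseteq> perp (perp {x \<odot> y})" by (intro biperp_mono) simp
    then show ?thesis using y(1) by blast
  qed
  ultimately show ?thesis by (simp add: alpha_filter_def)
qed

text \<open>For \<open>a \<in> perp {y}\<close> and \<open>b \<in> perp {x}\<close>, the join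
  \<open>sup a b\<close> lies in both annihilators, hence in
  \<open>perp {x \<odot> y}\<close>.\<close>

lemma perp_inter_trivial_complement:
  assumes y: "y \<in> perp {x}" and triv: "perp {x \<odot> y} \<subseteq> {top}"
  shows "perp (perp {x}) = perp {y}"
proof
  show "perp (perp {x}) \<subseteq> perp {y}" using y by (intro perp_antimono) simp
  show "perp {y} \<subseteq> perp (perp {x})"
    unfolding perp_def[of "perp {x}"]
  proof (intro subsetI CollectI ballI)
    fix a b assume "a \<in> perp {y}" "b \<in> perp {x}"
    then have "sup a b \<in> perp {y}" "sup a b \<in> perp {x}"
      using rl_filter_upward[OF rl_filter_perp] by (metis sup.cobounded1, metis sup.cobounded2)
    then show "sup a b = top" using triv by (auto simp: perp_rmult)
  qed
qed

lemma quasicomplementedI: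
  assumes c4: "\<And>F::'a set. proper_filter F \<Longrightarrow> alpha_filter F \<Longrightarrow>
    \<exists>M. minimal_prime_filter M \<and> F \<subseteq> M"
  shows "quasicomplemented TYPE('a::residuated_lattice)"
  unfolding quasicomplemented_def
proof
  fix x :: 'a
  let ?F = "\<Union>y\<in>perp {x}. perp (perp {x \<odot> y})"
  have mem: "x \<in> ?F" "perp {x} \<subseteq> ?F"
  proof -
    have *: "x \<odot> y \<in> perp (perp {x \<odot> y})" for y using perp_extensive by blast
    \<comment> \<open>The index \<open>top \<in> perp {x}\<close> accounts for \<open>x\<close>
      itself.\<close>
    have "x \<in> perp (perp {x \<odot> top})" using *[of top] by (simp add: rmult_top)
    then show "x \<in> ?F" using rl_filter_top[OF rl_filter_perp] by blast
    have "y \<in> perp (perp {x \<odot> y})" for y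
      using rl_filter_upward[OF rl_filter_perp *] rmult_le2 by blast
    then show "perp {x} \<subseteq> ?F" by blast
  qed
  have "\<not> proper_filter ?F"
  proof
    assume "proper_filter ?F"
    then obtain M where "minimal_prime_filter M" "?F \<subseteq> M"
      using c4 alpha_filter_Union_biperp by blast
    then show False using minimal_prime_filterE[of M x] mem by blast
  qed
  then have "bot \<in> ?F"
    using alpha_filter_Union_biperp[of x] by (auto simp: proper_filter_def alpha_filter_def)
  then obtain y where y: "y \<in> perp {x}" "bot \<in> perp (perp {x \<odot> y})" by blast
  \<comment> \<open>Every \<open>c\<close> annihilated by \<open>bot\<close> satisfies
    \<open>c = sup bot c = top\<close>.\<close>
  then have "perp {x \<odot> y} \<subseteq> {top}" by (auto simp: perp_def[of "perp {x \<odot> y}"])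
  then show "\<exists>y. perp (perp {x}) = perp {y}" using perp_inter_trivial_complement y(1) by blast
qed

theorem corollary5p16:
  defines "c1 \<equiv> quasicomplemented TYPE('a::residuated_lattice)"
    and "c2 \<equiv> \<forall>P::'a set. prime_filter P \<and> alpha_filter P \<longrightarrow> minimal_prime_filter P"
    and "c3 \<equiv> \<forall>F::'a set. proper_filter F \<and> alpha_filter F \<longrightarrow>
                (\<exists>S. (\<forall>M\<in>S. minimal_prime_filter M) \<and> F = \<Inter>S)"
    and "c4 \<equiv> \<forall>F::'a set. proper_filter F \<and> alpha_filter F \<longrightarrow>
                (\<exists>M. minimal_prime_filter M \<and> F \<subseteq> M)"
  shows "(c1 \<longleftrightarrow> c2) \<and> (c2 \<longleftrightarrow> c3) \<and> (c3 \<longleftrightarrow> c4)"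
proof -
  \<comment> \<open>The equivalences are closed as a cycle from \<open>c1\<close> through
    \<open>c2\<close>, \<open>c3\<close> and \<open>c4\<close> back to \<open>c1\<close>.\<close>
  have "c2" if "c1"
    using that quasicomplemented_minimal_prime unfolding c1_def c2_def by blast
  moreover have "c3" if "c2"
    unfolding c3_def
  proof (intro allI impI)
    fix F :: "'a set" assume "proper_filter F \<and> alpha_filter F"
    then show "\<exists>S. (\<forall>M\<in>S. minimal_prime_filter M) \<and> F = \<Inter>S"
      using \<open>c2\<close> alpha_filter_Inter_prime[of F] unfolding c2_def
      by (intro exI[of _ "{P. prime_filter P \<and> alpha_filter P \<and> F \<subseteq> P}"]) blast
  qed
  moreover have "c4" if "c3"
    unfolding c4_def
  proof (intro allI impI)
    fix F :: "'a set" assume F: "proper_filter F \<and> alpha_filter F"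
    then obtain S where S: "\<forall>M\<in>S. minimal_prime_filter M" "F = \<Inter>S"
      using \<open>c3\<close> unfolding c3_def by blast
    \<comment> \<open>An empty \<open>S\<close> would give \<open>\<Inter>S = UNIV\<close>, while
      \<open>F\<close> is proper.\<close>
    moreover have "S \<noteq> {}" using F S(2) by (auto simp: proper_filter_def)
    ultimately show "\<exists>M. minimal_prime_filter M \<and> F \<subseteq> M" by blast
  qed
  moreover have "c1" if "c4"
    using that quasicomplementedI unfolding c1_def c4_def by blast
  ultimately show ?thesis by blast
qed

end
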